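(* Let $n\geq 3$ and let $\ell$ be an integer with $9n/10 \leq \ell \leq n$. If $G$ and $G'$ are graphs on $n$ vertices with $\mathcal{D}_\ell(G)=\mathcal{D}_\ell(G')$, then $G$ is connected if and only if $G'$ is connected.
   Context: All graphs are finite, simple and undirected. For a graph $G$ and an integer $\ell$, the $\ell$-deck $\mathcal{D}_\ell(G)$ is the multiset of isomorphism classes of all induced subgraphs of $G$ on exactly $\ell$ vertices (one for each $\ell$-subset of $V(G)$). *)

theory Defs
  imports Complex_Main "HOL-Library.Multiset" "Graph_Theory.Graph_Theory"
begin

text \<open>
  Finite simple undirected graphs are the \<^locale>\<open>pair_graph\<close>s: finite digraphs without loops
  whose arcs are ordered pairs of vertices (hence no parallel arcs) and form a symmetric relation.

  The isomorphism class of a graph is represented by the set of all graphs on natural numbers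
  isomorphic to it. A class comprising graphs over every type cannot be formed in HOL, but every
  finite graph has a copy on natural numbers, so two graphs, possibly over different vertex
  types, get the same set if and only if they are isomorphic (lemma \<open>iso_class_eq_iff\<close>).
\<close>

definition iso_class :: "('a, 'b) pre_digraph \<Rightarrow> nat pair_pre_digraph set" where
  "iso_class G = {H. pair_graph H \<and> digraph_iso G (with_proj H)}"

definition deck :: "nat \<Rightarrow> 'a pair_pre_digraph \<Rightarrow> nat pair_pre_digraph set multiset" where
  "deck l G = image_mset (\<lambda>S. iso_class (with_proj G \<restriction> S))
                (mset_set {S. S \<subseteq> pverts G \<and> card S = l})"

lemma iso_class_nonempty:
  assumes "graph G" shows "iso_class G \<noteq> {}"
proof -
  interpret graph G by fact
  obtain f :: "'a \<Rightarrow> nat" where f: "inj_on f (verts G)"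
    using finite_imp_inj_to_nat_seg[OF finite_verts] by blast
  define h where "h = \<lparr>iso_verts = f, iso_arcs = (\<lambda>e. (f (tail G e), f (head G e))),
    iso_head = snd, iso_tail = fst\<rparr>"
  define H where "H = \<lparr>pverts = f ` verts G, parcs = (\<lambda>e. (f (tail G e), f (head G e))) ` arcs G\<rparr>"
  have iso: "pre_digraph.digraph_isomorphism G h"
    unfolding digraph_isomorphism_def
  proof (intro conjI)
    show "wf_digraph G" by unfold_locales
    show "inj_on (iso_arcs h) (arcs G)"
      using f no_multi_arcs by (fastforce simp: h_def inj_on_def arc_to_ends_def)
  qed (auto simp: h_def f)
  have eq: "with_proj H = app_iso h G"
    by (simp add: with_proj_def H_def h_def app_iso_def)
  have "pair_graph H"
  proof
    show "symmetric (with_proj H)"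
      using sym_arcs unfolding symmetric_conv by (simp add: H_def) metis
  next
    fix e assume "e \<in> parcs H"
    then show "fst e \<noteq> snd e"
      using f no_loops by (force simp: H_def inj_on_def)
  qed (auto simp: H_def)
  with iso eq show ?thesis
    by (auto simp: iso_class_def digraph_iso_def)
qed

lemma iso_class_eq_iff:
  assumes "graph G" "graph H"
  shows "iso_class G = iso_class H \<longleftrightarrow> digraph_iso G H"
proof -
  interpret G: graph G by fact
  interpret H: graph H by fact
  have wf: "wf_digraph G" "wf_digraph H" by unfold_locales
  show ?thesis
  proof
    assume eq: "iso_class G = iso_class H"
    obtain K where "K \<in> iso_class G" using iso_class_nonempty[OF assms(1)] by blast
    with eq have "digraph_iso G K" "digraph_iso H K" by (auto simp: iso_class_def)
    then show "digraph_iso G H"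
      using wf by (blast intro: digraph_iso_trans digraph_iso_swap)
  next
    assume "digraph_iso G H"
    moreover from this have "digraph_iso H G" using wf by (blast intro: digraph_iso_swap)
    ultimately show "iso_class G = iso_class H"
      by (auto simp: iso_class_def intro: digraph_iso_trans)
  qed
qed

end

theory Submission
  imports Defs
begin

text \<open>
  Suppose \<open>G\<close> is connected and \<open>G'\<close> is not, and put \<open>r = n - l\<close>, so that \<open>10 r \<le> n\<close>. A connected
  \<open>l\<close>-card lies in one component of \<open>G'\<close>, so the remaining vertices of \<open>G'\<close> form a nonempty set of
  some size \<open>c \<le> r\<close> without outside neighbours. For a \<open>c\<close>-set \<open>X\<close> let \<open>d X\<close> be the number of its
  outside neighbours. For \<open>c + j \<le> l\<close> the deck determines the number of pairs \<open>(X, Y)\<close> of disjoint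
  sets of sizes \<open>c\<close> and \<open>j\<close> with no edge between them, which is the sum of
  \<open>(n - c - d X) choose j\<close> over all \<open>X\<close>. Hence it determines the sum of \<open>f (d X)\<close> for every
  polynomial \<open>f\<close> of degree at most \<open>l - c\<close>. Take for \<open>f\<close> the product of the factors \<open>t - i\<close> over
  all \<open>t \<in> {1..n - c}\<close> except the \<open>r\<close> multiples of 3 given by \<open>t = 3 (r + a)\<close>, \<open>1 \<le> a \<le> r\<close>. Then
  \<open>2 (n choose c) \<bar>f i\<bar> \<le> \<bar>f 0\<bar>\<close> for \<open>1 \<le> i \<le> n - c\<close>, so the at most \<open>2 (n choose c) - 1\<close> sets \<open>X\<close>
  of the two graphs with \<open>d X > 0\<close> cannot balance a set of \<open>G'\<close> with \<open>d X = 0\<close>, whereas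
  \<open>G\<close> has no such set.
\<close>

subsection \<open>Binomial estimates\<close>

text \<open>The left side is a single term of Vandermonde's convolution.\<close>

lemma choose_mult_le_choose_add:
  "(m choose i) * (k choose j) \<le> (m + k) choose (i + j)"
proof -
  have "(m choose i) * (k choose ((i + j) - i)) \<le> (\<Sum>t\<le>i + j. (m choose t) * (k choose (i + j - t)))"
    by (rule member_le_sum) auto
  then show ?thesis by (simp add: vandermonde)
qed

text \<open>Together the hypotheses say that \<open>j\<close> is at least as close to the middle
  \<open>m / 2\<close> as \<open>i\<close>, on whichever side of it \<open>j\<close> lies.\<close>

lemma choose_mono_middle:
  assumes "i \<le> j" "i + j \<le> m"
  shows "(m choose i) \<le> (m choose j)"
proof (cases "2 * j \<le> m")
  case True
  then show ?thesis using assms by (intro binomial_mono) auto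
next
  case False
  have "(m choose i) \<le> (m choose (m - j))"
    using assms False by (intro binomial_mono) auto
  also have "\<dots> = (m choose j)"
    using assms by (intro binomial_symmetric[symmetric]) auto
  finally show ?thesis .
qed

lemma Suc_mult_choose_Suc:
  "Suc j * (k choose Suc j) = (k - j) * (k choose j)"
  by (metis binomial_absorb_comp binomial_absorption)

lemma fact_mult_choose_eq_prod:
  assumes "r \<le> n"
  shows "fact r * (n choose r) = (\<Prod>i<r. n - i)"
  using assms
proof (induction r)
  case (Suc r)
  have "fact (Suc r) * (n choose Suc r) = fact r * (Suc r * (n choose Suc r))"
    by (simp only: fact_Suc of_nat_id ac_simps)
  also have "Suc r * (n choose Suc r) = (n - r) * (n choose r)"
    by (rule Suc_mult_choose_Suc)
  also have "fact r * ((n - r) * (n choose r)) = (fact r * (n choose r)) * (n - r)"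
    by simp
  finally show ?case using Suc by simp
qed simp

text \<open>Multiplying by \<open>(fact r)^2 * (2 * r choose r)\<close> splits the right side into
  two binomials over \<open>r\<close>, so both sides become products of \<open>r\<close> factors
  that can be compared one by one.\<close>

lemma choose_le_choose_sub_4:
  assumes "10 * r \<le> n"
  shows "(n choose r) \<le> ((n - 4 * r) choose (2 * r))"
proof -
  have termwise: "(n - i) * (2 * r - i) \<le> (n - 4 * r - i) * (n - 5 * r - i)" if "i < r" for i
  proof -
    \<comment> \<open>With \<open>r = i + u\<close> and \<open>n = 10 * r + y\<close> no subtraction
      is left, and each coefficient of the polynomial on the left is at most the matching one on the
      right.\<close>
    obtain y where y: "n = 10 * r + y" using assms le_Suc_ex by blast
    define u where "u = r - i"
    have u: "r = i + u" using that by (simp add: u_def)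
    have 1: "n - i = 9 * i + 10 * u + y" "2 * r - i = i + 2 * u"
      "n - 4 * r - i = 5 * i + 6 * u + y" "n - 5 * r - i = 4 * i + 5 * u + y"
      using y u by auto
    show ?thesis unfolding 1 by (simp add: algebra_simps)
  qed
  have "(fact r * (n choose r)) * (fact r * (2 * r choose r))
      = (\<Prod>i<r. (n - i) * (2 * r - i))"
    using assms by (simp add: fact_mult_choose_eq_prod prod.distrib)
  also have "\<dots> \<le> (\<Prod>i<r. (n - 4 * r - i) * (n - 5 * r - i))"
    using termwise by (intro prod_mono) auto
  also have "\<dots> = (fact r * ((n - 4 * r) choose r)) * (fact r * ((n - 5 * r) choose r))"
    using assms by (simp add: fact_mult_choose_eq_prod prod.distrib)
  finally have "(fact r * fact r) * ((n choose r) * (2 * r choose r))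
      \<le> (fact r * fact r) * (((n - 4 * r) choose r) * ((n - 5 * r) choose r))"
    by (simp only: ac_simps)
  then have "(n choose r) * (2 * r choose r) \<le> ((n - 4 * r) choose r) * ((n - 5 * r) choose r)"
    by simp
  also have "\<dots> = ((n - 4 * r) choose (2 * r)) * (2 * r choose r)"
    using choose_mult[of r "2 * r" "n - 4 * r"] assms by (simp add: mult_2)
  finally show ?thesis by simp
qed

text \<open>This is the numerical content of the bound on \<open>f\<close> at the omitted nodes. The
  index splits as \<open>2 * (r + a) + (r + a)\<close>, and the three factors on the left are merged
  into one binomial over \<open>n - r\<close>.\<close>

lemma choose_product_bound:
  assumes "10 * r \<le> n" "c \<le> r" "a \<le> r"
  shows "(n choose c) * (2 * r choose r) * (r choose a) \<le> ((n - c) choose (3 * (r + a)))"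
proof -
  have "(n choose c) \<le> (n choose r)"
    using assms by (intro binomial_mono) auto
  also have "\<dots> \<le> ((n - 4 * r) choose (2 * r))"
    using assms by (intro choose_le_choose_sub_4)
  \<comment> \<open>Requires \<open>2 * r + 2 * (r + a) \<le> n - 4 * r\<close>, which for
    \<open>a = r\<close> is exactly \<open>10 * r \<le> n\<close>.\<close>
  also have "\<dots> \<le> ((n - 4 * r) choose (2 * (r + a)))"
    using assms by (intro choose_mono_middle) auto
  finally have 1: "(n choose c) \<le> \<dots>" .
  have "(n choose c) * ((2 * r choose r) * (r choose a))
      \<le> ((n - 4 * r) choose (2 * (r + a))) * ((2 * r + r) choose (r + a))"
    by (intro mult_le_mono 1 choose_mult_le_choose_add)
  also have "\<dots> \<le> ((n - 4 * r + (2 * r + r)) choose (2 * (r + a) + (r + a)))"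
    by (rule choose_mult_le_choose_add)
  also have "\<dots> = ((n - r) choose (3 * (r + a)))"
    using assms by simp
  also have "\<dots> \<le> ((n - c) choose (3 * (r + a)))"
    using assms by (intro binomial_right_mono) auto
  finally show ?thesis by simp
qed

section \<open>Products of linear factors as polynomial test functions\<close>

lemma prod_dist_interval:
  assumes "1 \<le> a" "a \<le> n"
  shows "(\<Prod>t\<in>{1..n} - {a}. \<bar>real t - real a\<bar>) = fact (a - 1) * fact (n - a)"
proof -
  have split: "{1..n} - {a} = {1..<a} \<union> {a<..n}" using assms by auto
  have "(\<Prod>t\<in>{1..<a}. \<bar>real t - real a\<bar>) = (\<Prod>s\<in>{1..a - 1}. real s)"
    by (rule prod.reindex_bij_witness[where i = "\<lambda>s. a - s" and j = "\<lambda>t. a - t"])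
      (auto simp: of_nat_diff)
  moreover have "(\<Prod>t\<in>{a<..n}. \<bar>real t - real a\<bar>) = (\<Prod>s\<in>{1..n - a}. real s)"
    by (rule prod.reindex_bij_witness[where i = "\<lambda>s. a + s" and j = "\<lambda>t. t - a"])
      (auto simp: of_nat_diff)
  ultimately show ?thesis
    unfolding split by (subst prod.union_disjoint) (auto simp: fact_prod)
qed

text \<open>Multiplication by the variable, expressed in the basis of binomial polynomials.\<close>

lemma choose_mult_self:
  "real (k choose j) * real k = real j * real (k choose j) + real (Suc j) * real (k choose Suc j)"
proof -
  have "real (Suc j) * real (k choose Suc j) = real (k - j) * real (k choose j)"
    by (metis Suc_mult_choose_Suc of_nat_mult)
  also have "\<dots> = (real k - real j) * real (k choose j)"
    by (cases "j \<le> k") (simp_all add: of_nat_diff)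
  finally show ?thesis by (simp add: algebra_simps del: of_nat_Suc)
qed

text \<open>Binomials up to index \<open>m\<close> span the polynomials of degree at most
  \<open>m\<close>. The extra factor \<open>choose j\<close> lets the induction absorb one linear
  factor at a time, at the price of raising \<open>j\<close> by one.\<close>

lemma sum_prod_eq_if_binomial_sums_eq:
  fixes z :: "'x \<Rightarrow> nat" and z' :: "'y \<Rightarrow> nat" and b :: "'t \<Rightarrow> real"
  assumes binom: "\<And>j. j \<le> m \<Longrightarrow>
      (\<Sum>x\<in>A. real (z x choose j)) = (\<Sum>x\<in>B. real (z' x choose j))"
    and "finite T" "j + card T \<le> m"
  shows "(\<Sum>x\<in>A. real (z x choose j) * (\<Prod>t\<in>T. real (z x) - b t))
       = (\<Sum>x\<in>B. real (z' x choose j) * (\<Prod>t\<in>T. real (z' x) - b t))"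
  using assms(2,3)
proof (induction T arbitrary: j rule: finite_induct)
  case empty
  then show ?case using binom by simp
next
  case (insert s T)
  define p where "p k = (\<Prod>t\<in>T. real k - b t)" for k :: nat
  have step: "real (k choose j) * (\<Prod>t\<in>insert s T. real k - b t)
      = real (Suc j) * (real (k choose Suc j) * p k) + (real j - b s) * (real (k choose j) * p k)"
    for k :: nat
  proof -
    have "real (k choose j) * (\<Prod>t\<in>insert s T. real k - b t)
      = (real (k choose j) * real k - b s * real (k choose j)) * p k"
      using insert.hyps by (simp add: p_def left_diff_distrib right_diff_distrib)
    also have "\<dots> = (real j * real (k choose j) + real (Suc j) * real (k choose Suc j)
        - b s * real (k choose j)) * p k"
      by (subst choose_mult_self) (rule refl)
    finally show ?thesis by (simp add: algebra_simps del: of_nat_Suc)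
  qed
  have "Suc j + card T \<le> m" "j + card T \<le> m" using insert by auto
  note IH = this[THEN insert.IH, folded p_def]
  \<comment> \<open>The type of \<open>X\<close> is kept general so that this rewrites the sums over
    \<open>A\<close> and over \<open>B\<close> alike.\<close>
  have split: "(\<Sum>x\<in>X. real (w x choose j) * (\<Prod>t\<in>insert s T. real (w x) - b t))
      = real (Suc j) * (\<Sum>x\<in>X. real (w x choose Suc j) * p (w x))
        + (real j - b s) * (\<Sum>x\<in>X. real (w x choose j) * p (w x))"
    for X :: "'z set" and w
    unfolding step sum.distrib sum_distrib_left by (rule refl)
  show ?case
    unfolding split IH by (rule refl)
qed

text \<open>
  Completing both products to all of \<open>{1..n - c}\<close> shows that their quotient is
  \<open>(2 * r choose r) * (r choose a) * a / ((r + a) * (n - c choose i))\<close>.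
\<close>

lemma prod_off_nodes_le:
  fixes n c r a :: nat
  defines "M \<equiv> (\<lambda>b. 3 * (r + b)) ` {1..r}" and "i \<equiv> 3 * (r + a)"
  assumes "10 * r \<le> n" "c \<le> r" "1 \<le> a" "a \<le> r"
  shows "2 * real (n choose c) * (\<Prod>t\<in>{1..n - c} - M. \<bar>real t - real i\<bar>)
    \<le> (\<Prod>t\<in>{1..n - c} - M. real t)"
proof -
  define N where "N = n - c"
  have i: "1 \<le> i" "i \<le> N" "i \<in> M" using assms by (auto simp: N_def)
  have M: "M \<subseteq> {1..N}" "finite M" using assms by (auto simp: N_def)
  have inj: "inj_on (\<lambda>b. 3 * (r + b)) X" for X by (auto simp: inj_on_def)
  define P where "P = (\<Prod>t\<in>{1..N} - M. \<bar>real t - real i\<bar>)"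
  define W where "W = (\<Prod>t\<in>{1..N} - M. real t)"
  define A where "A = (fact (a - 1) * fact (r - a) :: real)"
  define I where "I = (fact (i - 1) * fact (N - i) :: real)"
  have pos: "A > 0" "I > 0" by (auto simp: A_def I_def)
  have "(\<Prod>t\<in>M - {i}. \<bar>real t - real i\<bar>) = (\<Prod>b\<in>{1..r} - {a}. 3 * \<bar>real b - real a\<bar>)"
  proof -
    have "M - {i} = (\<lambda>b. 3 * (r + b)) ` ({1..r} - {a})"
      by (auto simp: M_def i_def)
    moreover have "\<bar>real (3 * (r + b)) - real i\<bar> = 3 * \<bar>real b - real a\<bar>" for b
      by (simp add: i_def abs_if)
    ultimately show ?thesis by (simp only: prod.reindex[OF inj] o_def)
  qed
  also have "\<dots> = 3 ^ (r - 1) * A"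
    using prod_dist_interval[of a r] assms(5,6) by (simp add: prod.distrib A_def)
  finally have PM: "(\<Prod>t\<in>M - {i}. \<bar>real t - real i\<bar>) = 3 ^ (r - 1) * A" .
  have "{1..N} - {i} = ({1..N} - M) \<union> (M - {i})" using M i by auto
  then have "P * (3 ^ (r - 1) * A) = (\<Prod>t\<in>{1..N} - {i}. \<bar>real t - real i\<bar>)"
    unfolding P_def PM[symmetric] by (subst prod.union_disjoint[symmetric]) (use M in auto)
  then have P: "P * (3 ^ (r - 1) * A) = I"
    using i by (simp only: prod_dist_interval I_def)
  have "fact r * (\<Prod>b\<in>{1..r}. real (r + b)) = (\<Prod>t\<in>{1..r}. real t) * (\<Prod>t\<in>{r + 1..r + r}. real t)"
    using prod.shift_bounds_cl_nat_ivl[of real 1 r r] by (simp add: fact_prod add.commute)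
  also have "\<dots> = fact (2 * r)"
    using prod.ub_add_nat[of 1 r real r] by (simp add: fact_prod mult_2)
  finally have shifted: "fact r * (\<Prod>b\<in>{1..r}. real (r + b)) = fact (2 * r)" .
  have "{1..N} = ({1..N} - M) \<union> M" using M by auto
  then have "fact N = W * (\<Prod>t\<in>M. real t)"
    unfolding W_def fact_prod of_nat_prod
    by (subst prod.union_disjoint[symmetric]) (use M in auto)
  also have "(\<Prod>t\<in>M. real t) = 3 ^ r * (\<Prod>b\<in>{1..r}. real (r + b))"
    unfolding M_def
    by (simp only: prod.reindex[OF inj] o_def of_nat_mult prod.distrib) simp
  finally have W: "fact N * fact r = W * 3 ^ r * fact (2 * r)"
    by (simp flip: shifted)
  have "real (n choose c) * real (2 * r choose r) * real (r choose a) \<le> real (N choose i)"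
    using choose_product_bound[of r n c a] assms unfolding N_def i_def
    by (metis of_nat_le_iff of_nat_mult)
  moreover have "real (2 * r choose r) = fact (2 * r) / (fact r * fact r)"
    by (simp add: binomial_fact)
  moreover have "real (r choose a) = fact r / (real a * A)"
    using assms by (simp add: binomial_fact A_def fact_reduce[of a])
  moreover have "real (N choose i) = fact N / (real i * I)"
    using i by (simp add: binomial_fact I_def fact_reduce[of i])
  ultimately have "real (n choose c) * (fact (2 * r) / (fact r * fact r)) * (fact r / (real a * A))
      \<le> fact N / (real i * I)"
    by simp
  moreover have "real a > 0" "real i > 0" using assms by (auto simp: i_def)
  ultimately have key: "real (n choose c) * fact (2 * r) * real i * I
      \<le> (fact N * fact r) * real a * A"
    using pos by (simp add: field_simps)
  \<comment> \<open>\<open>M - {i}\<close> has only \<open>r - 1\<close> elements, so one factor 3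
    is left over.\<close>
  have "P * 3 ^ r * A = 3 * I"
    using P assms by (cases r) (auto simp: algebra_simps)
  then have "real (n choose c) * fact (2 * r) * real i * (P * 3 ^ r * A)
      \<le> 3 * (W * 3 ^ r * fact (2 * r)) * real a * A"
    using key unfolding W by simp
  then have "real i * (real (n choose c) * P) * (fact (2 * r) * 3 ^ r * A)
      \<le> 3 * real a * W * (fact (2 * r) * 3 ^ r * A)"
    by (simp only: ac_simps)
  then have "real i * (real (n choose c) * P) \<le> 3 * real a * W"
    using pos by (subst (asm) mult_le_cancel_right) auto
  moreover have "0 \<le> P" unfolding P_def by (intro prod_nonneg) simp
  \<comment> \<open>\<open>a \<le> r\<close> gives \<open>i \<ge> 6 * a\<close>; against the surplus
    factor 3 this produces the 2 of the claim.\<close>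
  then have "6 * real a * (real (n choose c) * P) \<le> real i * (real (n choose c) * P)"
    using assms(6) \<open>0 \<le> P\<close> by (intro mult_right_mono) (auto simp: i_def)
  moreover have "3 * real a * (2 * real (n choose c) * P) = 6 * real a * (real (n choose c) * P)"
    by simp
  ultimately have "3 * real a * (2 * real (n choose c) * P) \<le> 3 * real a * W"
    by linarith
  then have "2 * real (n choose c) * P \<le> W"
    using \<open>real a > 0\<close> by (subst (asm) mult_le_cancel_left) auto
  then show ?thesis by (simp add: P_def W_def N_def)
qed

section \<open>Comparing the two families of sets by a weighing argument\<close>

text \<open>The terms with \<open>e x = 0\<close> all equal \<open>f 0\<close>, so they cannot
  cancel each other, and all remaining terms together stay below
  \<open>\<bar>f 0\<bar>\<close>.\<close>

lemma sums_differ_if_zero_attained: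
  fixes d :: "'x \<Rightarrow> nat" and e :: "'y \<Rightarrow> nat" and f :: "nat \<Rightarrow> real"
  assumes fin: "finite A" "finite B" and card: "card A = K" "card B = K"
    and A: "\<And>x. x \<in> A \<Longrightarrow> d x \<noteq> 0" and B: "y \<in> B" "e y = 0"
    and bdd: "\<And>x. x \<in> A \<Longrightarrow> 2 * real K * \<bar>f (d x)\<bar> \<le> \<bar>f 0\<bar>"
       "\<And>x. x \<in> B \<Longrightarrow> e x \<noteq> 0 \<Longrightarrow> 2 * real K * \<bar>f (e x)\<bar> \<le> \<bar>f 0\<bar>"
    and "f 0 \<noteq> 0"
  shows "(\<Sum>x\<in>A. f (d x)) \<noteq> (\<Sum>x\<in>B. f (e x))"
proof
  assume eq: "(\<Sum>x\<in>A. f (d x)) = (\<Sum>x\<in>B. f (e x))"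
  define b where "b = \<bar>f 0\<bar> / (2 * real K)"
  have K: "K > 0" using fin(2) B(1) card(2) by (auto simp: card_gt_0_iff)
  have le_b: "\<bar>t\<bar> \<le> b" if "2 * real K * \<bar>t\<bar> \<le> \<bar>f 0\<bar>" for t
    using that K by (simp add: b_def field_simps)
  define Z where "Z = {x \<in> B. e x = 0}"
  have Z: "finite Z" "Z \<subseteq> B" "Z \<noteq> {}" using fin B by (auto simp: Z_def)
  have "card Z \<le> K" using card_mono[OF fin(2) Z(2)] card by simp
  then have cardZ: "1 \<le> card Z" "card (B - Z) = K - card Z" "card Z \<le> K"
    using Z card by (auto simp: card_Diff_subset Suc_le_eq card_gt_0_iff)
  have "(\<Sum>x\<in>B. f (e x)) = (\<Sum>x\<in>Z. f (e x)) + (\<Sum>x\<in>B - Z. f (e x))"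
    using Z fin by (metis sum.subset_diff add.commute)
  also have "(\<Sum>x\<in>Z. f (e x)) = real (card Z) * f 0" by (simp add: Z_def)
  finally have "real (card Z) * f 0 = (\<Sum>x\<in>A. f (d x)) - (\<Sum>x\<in>B - Z. f (e x))"
    using eq by simp
  then have "\<bar>real (card Z) * f 0\<bar> \<le> \<bar>\<Sum>x\<in>A. f (d x)\<bar> + \<bar>\<Sum>x\<in>B - Z. f (e x)\<bar>"
    by linarith
  also have "\<dots> \<le> real (card A) * b + real (card (B - Z)) * b"
    using bdd le_b
    by (intro add_mono order_trans[OF sum_abs sum_bounded_above]) (auto simp: Z_def)
  also have "\<dots> = (2 * real K - real (card Z)) * b"
    using cardZ card by (simp add: of_nat_diff algebra_simps)
  \<comment> \<open>Strict because \<open>Z\<close> is nonempty: at most \<open>2 * K - 1\<close>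
    terms remain.\<close>
  also have "\<dots> < 2 * real K * b"
    using cardZ K \<open>f 0 \<noteq> 0\<close> by (intro mult_strict_right_mono) (auto simp: b_def)
  also have "\<dots> = \<bar>f 0\<bar>" using K by (simp add: b_def)
  finally have "real (card Z) * \<bar>f 0\<bar> < 1 * \<bar>f 0\<bar>" by (simp add: abs_mult)
  then show False using cardZ(1) \<open>f 0 \<noteq> 0\<close> by (subst (asm) mult_less_cancel_right) auto
qed

text \<open>The graph-free core of the argument: \<open>d\<close> and \<open>e\<close> stand for the
  numbers of outside neighbours of the \<open>c\<close>-sets in the two graphs.\<close>

lemma not_isolated_if_binomial_sums_eq:
  fixes d :: "'x \<Rightarrow> nat" and e :: "'y \<Rightarrow> nat"
  assumes "finite A" "finite B" "card A = n choose c" "card B = n choose c"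
    and "\<And>x. x \<in> A \<Longrightarrow> d x \<le> n - c" "\<And>x. x \<in> B \<Longrightarrow> e x \<le> n - c"
    and "10 * r \<le> n" "c \<le> r" "c + m + r = n"
    and binom: "\<And>j. j \<le> m \<Longrightarrow>
      (\<Sum>x\<in>A. real (n - c - d x choose j)) = (\<Sum>x\<in>B. real (n - c - e x choose j))"
    and "y \<in> B" "e y = 0"
  shows "\<exists>x\<in>A. d x = 0"
proof (rule ccontr)
  assume "\<not> (\<exists>x\<in>A. d x = 0)"
  then have pos: "\<And>x. x \<in> A \<Longrightarrow> d x \<noteq> 0" by auto
  define M where "M = (\<lambda>b. 3 * (r + b)) ` {1..r}"
  define T where "T = {1..n - c} - M"
  define f where "f i = (\<Prod>t\<in>T. real t - real i)" for i :: nat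
  have "inj_on (\<lambda>b. 3 * (r + b)) {1..r}" by (auto simp: inj_on_def)
  then have "card M = r" by (simp add: M_def card_image)
  moreover have "M \<subseteq> {1..n - c}" using assms(7,8) by (auto simp: M_def)
  moreover have "finite M" by (simp add: M_def)
  \<comment> \<open>Omitting \<open>r\<close> nodes brings the degree of \<open>f\<close> down from
    \<open>n - c\<close> to the available \<open>m\<close>.\<close>
  ultimately have T: "card T \<le> m" "finite T"
    using \<open>c + m + r = n\<close> by (auto simp: T_def card_Diff_subset)
  \<comment> \<open>The binomial sums are in the variable \<open>n - c - i\<close>, so each root
    \<open>t\<close> is reflected to \<open>n - c - t\<close>.\<close>
  have f_eq: "(\<Prod>t\<in>T. real (n - c - i) - (real (n - c) - real t)) = f i" if "i \<le> n - c" for i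
    unfolding f_def using that by (intro prod.cong) (auto simp: of_nat_diff)
  have "(\<Sum>x\<in>A. f (d x)) = (\<Sum>x\<in>A. \<Prod>t\<in>T. real (n - c - d x) - (real (n - c) - real t))"
    by (intro sum.cong refl f_eq[symmetric] assms(5))
  also have "\<dots> = (\<Sum>x\<in>B. \<Prod>t\<in>T. real (n - c - e x) - (real (n - c) - real t))"
    using T sum_prod_eq_if_binomial_sums_eq[OF binom,
      where j = 0 and T = T and b = "\<lambda>t. real (n - c) - real t"]
    by simp
  also have "\<dots> = (\<Sum>x\<in>B. f (e x))"
    by (intro sum.cong refl f_eq assms(6))
  finally have eq: "(\<Sum>x\<in>A. f (d x)) = (\<Sum>x\<in>B. f (e x))" .
  have f0: "\<bar>f 0\<bar> = (\<Prod>t\<in>T. real t)" "f 0 \<noteq> 0"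
    by (simp_all add: f_def abs_prod) (simp add: T_def)
  have bound: "2 * real (n choose c) * \<bar>f i\<bar> \<le> \<bar>f 0\<bar>" if "i \<noteq> 0" "i \<le> n - c" for i
  proof (cases "i \<in> T")
    case True
    then have "f i = 0" using T by (auto simp: f_def intro: prod_zero)
    then show ?thesis by simp
  next
    case False
    then have "i \<in> M" using that by (simp add: T_def)
    then obtain a where "a \<in> {1..r}" "i = 3 * (r + a)" by (auto simp: M_def)
    then show ?thesis
      unfolding f0 f_def abs_prod T_def M_def using prod_off_nodes_le[of r n c a] assms(7,8) by auto
  qed
  have "(\<Sum>x\<in>A. f (d x)) \<noteq> (\<Sum>x\<in>B. f (e x))"
    using assms(1-6,11,12) pos bound f0(2)
    by (intro sums_differ_if_zero_attained[where K = "n choose c" and y = y]) auto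
  then show False using eq by contradiction
qed

subsection \<open>Anticomplete pairs and the deck\<close>

text \<open>Only arcs from \<open>X\<close> to \<open>Y\<close> are tested; for symmetric
  \<open>E\<close> this rules out edges in either direction.\<close>

definition anticomplete_pairs :: "('a \<times> 'a) set \<Rightarrow> 'a set \<Rightarrow> nat \<Rightarrow> nat \<Rightarrow> ('a set \<times> 'a set) set" where
  "anticomplete_pairs E V c j = {(X, Y). X \<subseteq> V \<and> Y \<subseteq> V \<and> X \<inter> Y = {} \<and>
     card X = c \<and> card Y = j \<and> E \<inter> X \<times> Y = {}}"

lemma finite_anticomplete_pairs: "finite V \<Longrightarrow> finite (anticomplete_pairs E V c j)"
  by (rule finite_subset[of _ "Pow V \<times> Pow V"]) (auto simp: anticomplete_pairs_def)

lemma card_anticomplete_pairs_image: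
  assumes inj: "inj_on f V" and "E \<subseteq> V \<times> V"
  shows "card (anticomplete_pairs (map_prod f f ` E) (f ` V) c j) = card (anticomplete_pairs E V c j)"
proof -
  let ?F = "map_prod ((`) f) ((`) f)"
  have disj: "f ` X \<inter> f ` Y = {} \<longleftrightarrow> X \<inter> Y = {}" if "X \<subseteq> V" "Y \<subseteq> V" for X Y
    using inj_on_image_Int[OF inj that] by auto
  have arcs: "map_prod f f ` E \<inter> f ` X \<times> f ` Y = {} \<longleftrightarrow> E \<inter> X \<times> Y = {}"
    if "X \<subseteq> V" "Y \<subseteq> V" for X Y
  proof -
    have "map_prod f f ` E \<inter> map_prod f f ` (X \<times> Y) = map_prod f f ` (E \<inter> X \<times> Y)"
      using that assms(2) map_prod_inj_on[OF inj inj]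
      by (intro inj_on_image_Int[symmetric]) auto
    then show ?thesis by (simp add: map_prod_surj_on[OF refl refl])
  qed
  have card_im: "card (f ` X) = card X" if "X \<subseteq> V" for X
    using inj that by (meson card_image inj_on_subset)
  have "anticomplete_pairs (map_prod f f ` E) (f ` V) c j = ?F ` anticomplete_pairs E V c j"
  proof (intro set_eqI iffI)
    fix p assume "p \<in> anticomplete_pairs (map_prod f f ` E) (f ` V) c j"
    then obtain X Y where "X \<subseteq> V" "Y \<subseteq> V" "p = (f ` X, f ` Y)"
      "(f ` X, f ` Y) \<in> anticomplete_pairs (map_prod f f ` E) (f ` V) c j"
      by (auto simp: anticomplete_pairs_def subset_image_iff)
    then show "p \<in> ?F ` anticomplete_pairs E V c j"
      by (intro image_eqI[of _ _ "(X, Y)"]) (auto simp: anticomplete_pairs_def disj arcs card_im)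
  next
    fix p assume "p \<in> ?F ` anticomplete_pairs E V c j"
    then show "p \<in> anticomplete_pairs (map_prod f f ` E) (f ` V) c j"
      by (force simp: anticomplete_pairs_def disj arcs card_im)
  qed
  moreover have "inj_on ?F (Pow V \<times> Pow V)"
    by (intro map_prod_inj_on inj_on_image_Pow inj)
  then have "inj_on ?F (anticomplete_pairs E V c j)"
    by (rule inj_on_subset) (auto simp: anticomplete_pairs_def)
  ultimately show ?thesis by (simp add: card_image)
qed

lemma card_anticomplete_pairs_digraph_iso:
  assumes "digraph_iso D D'"
  shows "card (anticomplete_pairs (arcs_ends D') (verts D') c j)
       = card (anticomplete_pairs (arcs_ends D) (verts D) c j)"
proof -
  obtain h where h: "pre_digraph.digraph_isomorphism D h" and D': "D' = app_iso h D"
    using assms by (auto simp: digraph_iso_def)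
  then interpret wf_digraph D by (simp add: pre_digraph.digraph_isomorphism_def)
  have "arcs_ends D' = map_prod (iso_verts h) (iso_verts h) ` arcs_ends D"
    unfolding D' arcs_ends_app_iso_eq[OF h] by (simp add: map_prod_def)
  moreover have "arcs_ends D \<subseteq> verts D \<times> verts D"
    using adj_in_verts by auto
  ultimately show ?thesis
    using card_anticomplete_pairs_image[OF digraph_isomorphism_inj_on_verts[OF h]]
    by (simp add: D')
qed

lemma anticomplete_pairs_induce_subgraph:
  "anticomplete_pairs (arcs_ends (with_proj G \<restriction> S)) S c j = anticomplete_pairs (parcs G) S c j"
  by (fastforce simp: anticomplete_pairs_def arcs_ends_conv)

text \<open>Guarantees that a representative can be chosen from every card.\<close>

lemma iso_class_nonempty_induce_subgraph:
  assumes "pair_graph G" "S \<subseteq> pverts G"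
  shows "iso_class (with_proj G \<restriction> S) \<noteq> {}"
proof -
  interpret pair_graph G by fact
  have ind: "induced_subgraph (with_proj G \<restriction> S) (with_proj G)"
    using assms(2) by (intro induced_induce) simp
  interpret D: digraph "with_proj G \<restriction> S" using ind by (rule digraphI_induced)
  interpret S: sym_digraph "with_proj G \<restriction> S" using ind by (rule induced_graph_imp_graph)
  have "graph (with_proj G \<restriction> S)" by unfold_locales
  then show ?thesis by (rule iso_class_nonempty)
qed

lemma card_anticomplete_pairs_iso_class:
  assumes "K \<in> iso_class (with_proj G \<restriction> S)"
  shows "card (anticomplete_pairs (parcs K) (pverts K) c j) = card (anticomplete_pairs (parcs G) S c j)"
  using assms card_anticomplete_pairs_digraph_iso[of "with_proj G \<restriction> S" "with_proj K"]
  by (simp add: iso_class_def anticomplete_pairs_induce_subgraph)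

text \<open>Double counting as in Kelly's lemma: a pair \<open>(X, Y)\<close> is seen by exactly
  those \<open>l\<close>-sets \<open>S\<close> that contain \<open>X \<union> Y\<close>.\<close>

lemma sum_subsets_card_anticomplete_pairs:
  assumes "finite V" "c + j \<le> l"
  shows "(\<Sum>S | S \<subseteq> V \<and> card S = l. card (anticomplete_pairs E S c j))
    = card (anticomplete_pairs E V c j) * ((card V - (c + j)) choose (l - (c + j)))"
proof -
  let ?S = "{S. S \<subseteq> V \<and> card S = l}" and ?P = "anticomplete_pairs E V c j"
  have fin: "finite ?S" "finite ?P" using assms(1) by (auto intro: finite_anticomplete_pairs)
  have "card (anticomplete_pairs E S c j) = (\<Sum>p\<in>?P. if fst p \<union> snd p \<subseteq> S then 1 else 0)"
    if "S \<in> ?S" for S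
  proof -
    have "anticomplete_pairs E S c j = {p \<in> ?P. fst p \<union> snd p \<subseteq> S}"
      using that by (auto simp: anticomplete_pairs_def)
    then show ?thesis using fin by (simp add: sum.If_cases Int_def conj_commute)
  qed
  then have "(\<Sum>S\<in>?S. card (anticomplete_pairs E S c j))
      = (\<Sum>p\<in>?P. \<Sum>S\<in>?S. if fst p \<union> snd p \<subseteq> S then 1 else 0)"
    by (subst sum.swap) simp
  also have "\<dots> = (\<Sum>p\<in>?P. (card V - (c + j)) choose (l - (c + j)))"
  proof (rule sum.cong)
    fix p assume p: "p \<in> ?P"
    define U where "U = fst p \<union> snd p"
    have U: "U \<subseteq> V" using p by (auto simp: U_def anticomplete_pairs_def)
    then have finU: "finite U" using assms(1) finite_subset by blast
    then have cardU: "card U = c + j"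
      using p by (auto simp: U_def anticomplete_pairs_def card_Un_disjoint)
    have "bij_betw (\<lambda>R. R \<union> U) {R. R \<subseteq> V - U \<and> card R = l - (c + j)} {S \<in> ?S. U \<subseteq> S}"
    proof (rule bij_betw_byWitness[where f' = "\<lambda>S. S - U"])
      show "(\<lambda>R. R \<union> U) ` {R. R \<subseteq> V - U \<and> card R = l - (c + j)} \<subseteq> {S \<in> ?S. U \<subseteq> S}"
      proof safe
        fix R assume R: "R \<subseteq> V - U" "card R = l - (c + j)"
        then have "finite R" "R \<inter> U = {}" using assms(1) finite_subset by blast+
        then show "card (R \<union> U) = l" using R finU cardU assms(2) by (simp add: card_Un_disjoint)
      qed (use U in auto)
      show "(\<lambda>S. S - U) ` {S \<in> ?S. U \<subseteq> S} \<subseteq> {R. R \<subseteq> V - U \<and> card R = l - (c + j)}"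
        using finU cardU by (auto simp: card_Diff_subset)
    qed auto
    then have "card {S \<in> ?S. U \<subseteq> S} = card (V - U) choose (l - (c + j))"
      using assms(1) by (simp add: bij_betw_same_card[symmetric] n_subsets)
    then show "(\<Sum>S\<in>?S. if fst p \<union> snd p \<subseteq> S then 1 else 0) = (card V - (c + j)) choose (l - (c + j))"
      using fin U finU cardU by (simp add: sum.If_cases Int_def conj_commute card_Diff_subset flip: U_def)
  qed simp
  finally show ?thesis by simp
qed

text \<open>For fixed \<open>X\<close>, the admissible \<open>Y\<close> are the
  \<open>j\<close>-subsets of what is left of \<open>V\<close> after removing \<open>X\<close> and
  its outside neighbours.\<close>

lemma card_anticomplete_pairs_eq_sum:
  assumes "finite V"
  shows "card (anticomplete_pairs E V c j)
    = (\<Sum>X | X \<subseteq> V \<and> card X = c. (card V - c - card (E `` X \<inter> (V - X))) choose j)"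
proof -
  have "anticomplete_pairs E V c j
    = Sigma {X. X \<subseteq> V \<and> card X = c} (\<lambda>X. {Y. Y \<subseteq> V - X - E `` X \<and> card Y = j})"
    by (fastforce simp: anticomplete_pairs_def)
  then have "card (anticomplete_pairs E V c j)
      = (\<Sum>X | X \<subseteq> V \<and> card X = c. card (V - X - E `` X) choose j)"
    using assms by (simp add: card_SigmaI n_subsets)
  also have "\<dots> = (\<Sum>X | X \<subseteq> V \<and> card X = c. (card V - c - card (E `` X \<inter> (V - X))) choose j)"
  proof (rule sum.cong)
    fix X assume X: "X \<in> {X. X \<subseteq> V \<and> card X = c}"
    have "V - X - E `` X = (V - X) - E `` X \<inter> (V - X)" by auto
    then have "card (V - X - E `` X) = card (V - X) - card (E `` X \<inter> (V - X))"
      using assms card_Diff_subset[of "E `` X \<inter> (V - X)" "V - X"] by simp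
    also have "card (V - X) = card V - c"
      using X assms by (simp add: card_Diff_subset finite_subset[of X V])
    finally show "card (V - X - E `` X) choose j = (card V - c - card (E `` X \<inter> (V - X))) choose j"
      by simp
  qed simp
  finally show ?thesis .
qed

section \<open>Connectivity in terms of cuts\<close>

text \<open>Connectedness of the subgraph induced on \<open>V\<close>, without forming that
  subgraph: arcs of \<open>E\<close> leaving \<open>V\<close> have no effect. The empty set counts
  as linked.\<close>

definition linked :: "('a \<times> 'a) set \<Rightarrow> 'a set \<Rightarrow> bool" where
  "linked E V \<longleftrightarrow> (\<forall>X\<subseteq>V. X \<noteq> {} \<longrightarrow> X \<noteq> V \<longrightarrow> E \<inter> X \<times> (V - X) \<noteq> {})"

text \<open>When \<open>c + j = card S\<close>, an anticomplete pair is a partition of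
  \<open>S\<close> without crossing arcs. Hence linkedness of a card can be transferred through the
  counts alone.\<close>

lemma linked_iff_no_anticomplete_pairs:
  assumes "finite S"
  shows "linked E S \<longleftrightarrow>
    (\<forall>c j. 1 \<le> c \<and> 1 \<le> j \<and> c + j = card S \<longrightarrow> card (anticomplete_pairs E S c j) = 0)"
    (is "_ \<longleftrightarrow> ?R")
proof
  assume L: "linked E S"
  have "anticomplete_pairs E S c j = {}" if "1 \<le> c" "1 \<le> j" "c + j = card S" for c j
  proof (rule ccontr)
    assume "anticomplete_pairs E S c j \<noteq> {}"
    then obtain X Y where XY: "X \<subseteq> S" "Y \<subseteq> S" "X \<inter> Y = {}" "card X = c" "card Y = j" "E \<inter> X \<times> Y = {}"
      by (auto simp: anticomplete_pairs_def)
    have "finite X" "finite Y" using XY assms finite_subset by blast+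
    then have "X \<union> Y = S"
      using XY that assms by (intro card_subset_eq) (auto simp: card_Un_disjoint)
    then have "Y = S - X" using XY by auto
    moreover have "X \<noteq> {}" "Y \<noteq> {}" using XY that by auto
    ultimately show False using L XY unfolding linked_def by blast
  qed
  then show ?R by simp
next
  assume R: ?R
  show "linked E S"
    unfolding linked_def
  proof (intro allI impI notI)
    fix X assume X: "X \<subseteq> S" "X \<noteq> {}" "X \<noteq> S" "E \<inter> X \<times> (S - X) = {}"
    have fin: "finite X" "finite (S - X)" using X assms finite_subset by blast+
    then have "1 \<le> card X" "1 \<le> card (S - X)"
      using X by (auto simp: Suc_le_eq card_gt_0_iff)
    moreover have "card X + card (S - X) = card S"
      using X assms fin by (simp add: card_Diff_subset card_mono)
    ultimately have "card (anticomplete_pairs E S (card X) (card (S - X))) = 0"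
      using R by blast
    moreover have "(X, S - X) \<in> anticomplete_pairs E S (card X) (card (S - X))"
      using X by (auto simp: anticomplete_pairs_def)
    ultimately show False using finite_anticomplete_pairs[OF assms] by (metis card_eq_0_iff empty_iff)
  qed
qed

lemma linked_insert:
  assumes "linked E S" "sym E" "x \<in> S" "y \<notin> S" "(x, y) \<in> E"
  shows "linked E (insert y S)"
  unfolding linked_def
proof (intro allI impI)
  fix X assume X: "X \<subseteq> insert y S" "X \<noteq> {}" "X \<noteq> insert y S"
  have "(y, x) \<in> E" using assms by (auto dest: symD)
  \<comment> \<open>In the first two cases the edge between \<open>x\<close> and \<open>y\<close>
    crosses the cut; otherwise \<open>X\<close> already cuts \<open>S\<close> properly.\<close>
  consider "X = {y}" | "X = S" | "X \<inter> S \<noteq> {}" "X \<inter> S \<noteq> S"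
    using X by blast
  then show "E \<inter> X \<times> (insert y S - X) \<noteq> {}"
  proof cases
    case 3
    then have "E \<inter> (X \<inter> S) \<times> (S - X \<inter> S) \<noteq> {}"
      using assms(1) unfolding linked_def by blast
    then show ?thesis by blast
  qed (use assms \<open>(y, x) \<in> E\<close> in auto)
qed

text \<open>Starting from one vertex, a linked set grows along an arc that leaves it. This supplies
  the connected \<open>l\<close>-card.\<close>

lemma linked_subset_of_card:
  assumes "linked E V" "finite V" "sym E" "1 \<le> k" "k \<le> card V"
  obtains S where "S \<subseteq> V" "card S = k" "linked E S"
proof -
  have "\<exists>S\<subseteq>V. card S = k \<and> linked E S"
    using \<open>1 \<le> k\<close> \<open>k \<le> card V\<close>
  proof (induction k rule: dec_induct)
    case base
    then obtain x where "x \<in> V" by (metis card.empty not_one_le_zero ex_in_conv)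
    then show ?case by (intro exI[of _ "{x}"]) (auto simp: linked_def)
  next
    case (step k)
    then obtain S where S: "S \<subseteq> V" "card S = k" "linked E S"
      using Suc_leD by blast
    have "S \<noteq> {}" using S(2) step.hyps by auto
    moreover have "S \<noteq> V" using S(2) step.prems by auto
    ultimately obtain x y where "x \<in> S" "y \<in> V - S" "(x, y) \<in> E"
      using S(1) assms(1) unfolding linked_def by blast
    moreover have "finite S" using S assms(2) finite_subset by blast
    ultimately show ?case
      using S linked_insert[OF S(3) assms(3)] by (intro exI[of _ "insert y S"]) auto
  qed
  then show thesis using that by blast
qed

text \<open>No walk leaves a set without outgoing arcs, and the set of vertices reachable from
  \<open>u\<close> is such a set.\<close>

lemma connected_iff_linked:
  assumes "pair_graph G"
  shows "Digraph_Component.connected (with_proj G) \<longleftrightarrow> pverts G \<noteq> {} \<and> linked (parcs G) (pverts G)"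
proof -
  interpret pair_graph G by fact
  \<comment> \<open>Connectedness is defined through the symmetric closure, which here adds no
    arcs.\<close>
  have "symcl (parcs G) = parcs G"
    using arcs_symmetric by (auto simp: symcl_def)
  then have conn: "Digraph_Component.connected (with_proj G) \<longleftrightarrow>
      pverts G \<noteq> {} \<and> (\<forall>u\<in>pverts G. \<forall>v\<in>pverts G. u \<rightarrow>\<^sup>*\<^bsub>with_proj G\<^esub> v)"
    by (simp add: connected_conv reachable_def)
  show ?thesis
    unfolding conn
  proof (intro conj_cong refl iffI)
    assume reach: "\<forall>u\<in>pverts G. \<forall>v\<in>pverts G. u \<rightarrow>\<^sup>*\<^bsub>with_proj G\<^esub> v"
    show "linked (parcs G) (pverts G)"
      unfolding linked_def
    proof (intro allI impI notI)
      fix X assume X: "X \<subseteq> pverts G" "X \<noteq> {}" "X \<noteq> pverts G"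
        and none: "parcs G \<inter> X \<times> (pverts G - X) = {}"
      then obtain u v where uv: "u \<in> X" "v \<in> pverts G" "v \<notin> X" by blast
      then have "u \<rightarrow>\<^sup>*\<^bsub>with_proj G\<^esub> v" using reach X by blast
      then have "v \<in> X"
      proof (induction rule: reachable_induct)
        case (step x y)
        then show ?case using none adj_in_verts[of x y] by auto
      qed (use uv in auto)
      then show False using uv by blast
    qed
  next
    assume L: "linked (parcs G) (pverts G)"
    show "\<forall>u\<in>pverts G. \<forall>v\<in>pverts G. u \<rightarrow>\<^sup>*\<^bsub>with_proj G\<^esub> v"
    proof (intro ballI)
      fix u v assume uv: "u \<in> pverts G" "v \<in> pverts G"
      define X where "X = {w \<in> pverts G. u \<rightarrow>\<^sup>*\<^bsub>with_proj G\<^esub> w}"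
      have "parcs G \<inter> X \<times> (pverts G - X) = {}"
        using reachable_adj_trans by (fastforce simp: X_def)
      moreover have "u \<in> X" "X \<subseteq> pverts G" using uv by (auto simp: X_def)
      ultimately have "X = pverts G" using L unfolding linked_def by blast
      then show "u \<rightarrow>\<^sup>*\<^bsub>with_proj G\<^esub> v" using uv by (auto simp: X_def)
    qed
  qed
qed

section \<open>Counts determined by the deck\<close>

text \<open>The right side mentions \<open>G\<close> only through its deck. The arbitrary choice of
  a representative is harmless because the count is invariant under isomorphism.\<close>

lemma sum_card_anticomplete_pairs_deck:
  assumes "pair_graph G"
  shows "(\<Sum>S | S \<subseteq> pverts G \<and> card S = l. card (anticomplete_pairs (parcs G) S c j))
    = (\<Sum>K\<in>#deck l G. let H = SOME H. H \<in> K in card (anticomplete_pairs (parcs H) (pverts H) c j))"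
proof -
  have "card (anticomplete_pairs (parcs G) S c j)
      = (let H = SOME H. H \<in> iso_class (with_proj G \<restriction> S) in card (anticomplete_pairs (parcs H) (pverts H) c j))"
    if "S \<subseteq> pverts G" for S
    using iso_class_nonempty_induce_subgraph[OF assms that] card_anticomplete_pairs_iso_class
    by (metis some_in_eq)
  then have "(\<Sum>S | S \<subseteq> pverts G \<and> card S = l. card (anticomplete_pairs (parcs G) S c j))
    = (\<Sum>S | S \<subseteq> pverts G \<and> card S = l. let H = SOME H. H \<in> iso_class (with_proj G \<restriction> S)
        in card (anticomplete_pairs (parcs H) (pverts H) c j))"
    by (intro sum.cong) auto
  then show ?thesis
    by (simp add: deck_def sum_unfold_sum_mset image_mset.compositionality o_def)
qed

lemma card_anticomplete_pairs_eq_if_deck_eq: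
  assumes "pair_graph G" "pair_graph G'" "card (pverts G) = n" "card (pverts G') = n"
    and "deck l G = deck l G'" "c + j \<le> l" "l \<le> n"
  shows "card (anticomplete_pairs (parcs G) (pverts G) c j)
       = card (anticomplete_pairs (parcs G') (pverts G') c j)"
proof -
  interpret G: pair_graph G by fact
  interpret G': pair_graph G' by fact
  have fin: "finite (pverts G)" "finite (pverts G')"
    by (fact G.pair_finite_verts G'.pair_finite_verts)+
  have "(\<Sum>S | S \<subseteq> pverts G \<and> card S = l. card (anticomplete_pairs (parcs G) S c j))
      = (\<Sum>S | S \<subseteq> pverts G' \<and> card S = l. card (anticomplete_pairs (parcs G') S c j))"
    by (simp only: sum_card_anticomplete_pairs_deck[OF assms(1)]
        sum_card_anticomplete_pairs_deck[OF assms(2)] assms(5))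
  then have "card (anticomplete_pairs (parcs G) (pverts G) c j) * ((n - (c + j)) choose (l - (c + j)))
      = card (anticomplete_pairs (parcs G') (pverts G') c j) * ((n - (c + j)) choose (l - (c + j)))"
    by (simp only: sum_subsets_card_anticomplete_pairs[OF fin(1) assms(6)]
        sum_subsets_card_anticomplete_pairs[OF fin(2) assms(6)] assms(3,4))
  \<comment> \<open>Every pair is seen by at least one card, so the factor cancels.\<close>
  moreover have "(n - (c + j)) choose (l - (c + j)) \<noteq> 0"
    using assms(6,7) by (simp add: zero_less_binomial diff_le_mono)
  ultimately show ?thesis by simp
qed

text \<open>The class of the card on \<open>S\<close> also occurs in the other deck, and a common
  representative carries the counts across.\<close>

lemma deck_eq_obtains_subset:
  assumes "finite (pverts G)" "finite (pverts G')" "deck l G = deck l G'" "pair_graph G"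
    and "S \<subseteq> pverts G" "card S = l"
  obtains S' where "S' \<subseteq> pverts G'" "card S' = l"
    "\<And>c j. card (anticomplete_pairs (parcs G') S' c j) = card (anticomplete_pairs (parcs G) S c j)"
proof -
  have "iso_class (with_proj G \<restriction> S) \<in># deck l G"
    using assms(1,5,6) by (auto simp: deck_def)
  then have "iso_class (with_proj G \<restriction> S) \<in># deck l G'" using assms(3) by simp
  then obtain S' where S': "S' \<subseteq> pverts G'" "card S' = l"
    "iso_class (with_proj G' \<restriction> S') = iso_class (with_proj G \<restriction> S)"
    using assms(2) by (auto simp: deck_def)
  obtain K where "K \<in> iso_class (with_proj G \<restriction> S)"
    using iso_class_nonempty_induce_subgraph[OF assms(4,5)] by blast
  then show thesis
    using that[OF S'(1,2)] S'(3) card_anticomplete_pairs_iso_class by metis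
qed

lemma linked_if_deck_eq:
  fixes G :: "'a pair_pre_digraph" and G' :: "'b pair_pre_digraph"
  assumes G: "pair_graph G" "card (pverts G) = n" "linked (parcs G) (pverts G)"
    and G': "pair_graph G'" "card (pverts G') = n"
    and "1 \<le> l" "l \<le> n" "9 * n \<le> 10 * l" "deck l G = deck l G'"
  shows "linked (parcs G') (pverts G')"
proof (rule ccontr)
  let ?V = "pverts G" and ?E = "parcs G" and ?V' = "pverts G'" and ?E' = "parcs G'"
  assume "\<not> linked ?E' ?V'"
  then obtain C where C: "C \<subseteq> ?V'" "C \<noteq> {}" "C \<noteq> ?V'" "?E' \<inter> C \<times> (?V' - C) = {}"
    unfolding linked_def by blast
  interpret G: pair_graph G by fact
  interpret G': pair_graph G' by fact
  have fin: "finite ?V" "finite ?V'" by (fact G.pair_finite_verts G'.pair_finite_verts)+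
  have "sym ?E" "sym ?E'" using G.arcs_symmetric G'.arcs_symmetric by (auto intro: symI)
  obtain S where S: "S \<subseteq> ?V" "card S = l" "linked ?E S"
    using linked_subset_of_card[OF G(3) fin(1) \<open>sym ?E\<close>] assms(2,6,7) by metis
  obtain S' where S': "S' \<subseteq> ?V'" "card S' = l"
    "\<And>c j. card (anticomplete_pairs ?E' S' c j) = card (anticomplete_pairs ?E S c j)"
    using deck_eq_obtains_subset[OF fin assms(9) G(1) S(1,2)] by metis
  have "finite S" "finite S'" using S S' fin finite_subset by blast+
  then have "linked ?E' S'"
    using S S' by (simp add: linked_iff_no_anticomplete_pairs)
  \<comment> \<open>The separation \<open>C\<close> induces one of \<open>S'\<close>, so the linked
    set \<open>S'\<close> lies on one side of it; \<open>D\<close> is the other side.\<close>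
  moreover have "?E' \<inter> (S' \<inter> C) \<times> (S' - S' \<inter> C) = {}" using C S' by blast
  ultimately have "S' \<inter> C = {} \<or> S' \<inter> C = S'"
    unfolding linked_def by (meson Int_lower1)
  then have "\<exists>D. D \<subseteq> ?V' \<and> D \<noteq> {} \<and> D \<inter> S' = {} \<and> ?E' \<inter> D \<times> (?V' - D) = {}"
  proof
    assume "S' \<inter> C = S'"
    moreover have "?E' \<inter> (?V' - C) \<times> (?V' - (?V' - C)) = {}"
      using C \<open>sym ?E'\<close> by (auto dest: symD)
    ultimately show ?thesis using C by (intro exI[of _ "?V' - C"]) auto
  qed (use C in blast)
  then obtain D where D: "D \<subseteq> ?V'" "D \<noteq> {}" "D \<inter> S' = {}" "?E' \<inter> D \<times> (?V' - D) = {}"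
    by blast
  define c where "c = card D"
  define r where "r = n - l"
  have "finite D" using D fin finite_subset by blast
  then have "1 \<le> c" using D by (simp add: c_def Suc_le_eq card_gt_0_iff)
  have "card (D \<union> S') \<le> n"
    using D S' fin G'(2) by (metis card_mono Un_least)
  then have "c \<le> r"
    using D S' \<open>finite D\<close> \<open>finite S'\<close> by (simp add: c_def r_def card_Un_disjoint)
  \<comment> \<open>\<open>l - c\<close> takes the role of the degree bound \<open>m\<close>; it is
    a true difference because \<open>c \<le> r \<le> l\<close>.\<close>
  have r: "10 * r \<le> n" "c + (l - c) + r = n" using assms(6-8) \<open>c \<le> r\<close> by (auto simp: r_def)
  define d where "d X = card (?E `` X \<inter> (?V - X))" for X
  define d' where "d' X = card (?E' `` X \<inter> (?V' - X))" for X
  let ?A = "{X. X \<subseteq> ?V \<and> card X = c}" and ?B = "{X. X \<subseteq> ?V' \<and> card X = c}"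
  have "\<exists>X\<in>?A. d X = 0"
  proof (rule not_isolated_if_binomial_sums_eq)
    show "finite ?A" "finite ?B" using fin by auto
    show "card ?A = n choose c" "card ?B = n choose c" using fin G(2) G'(2) by (auto simp: n_subsets)
    show "10 * r \<le> n" "c \<le> r" "c + (l - c) + r = n" by fact+
    show "D \<in> ?B" using D by (simp add: c_def)
    have "?E' `` D \<inter> (?V' - D) = {}" using D(4) by blast
    then show "d' D = 0" by (simp add: d'_def)
  next
    fix X assume X: "X \<in> ?A"
    have "d X \<le> card (?V - X)" unfolding d_def using fin by (intro card_mono) auto
    then show "d X \<le> n - c" using X fin G(2) by (simp add: card_Diff_subset finite_subset[of X ?V])
  next
    fix X assume X: "X \<in> ?B"
    have "d' X \<le> card (?V' - X)" unfolding d'_def using fin by (intro card_mono) auto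
    then show "d' X \<le> n - c" using X fin G'(2) by (simp add: card_Diff_subset finite_subset[of X ?V'])
  next
    fix j assume "j \<le> l - c"
    then have "c + j \<le> l" using \<open>c \<le> r\<close> r by simp
    then have "card (anticomplete_pairs ?E ?V c j) = card (anticomplete_pairs ?E' ?V' c j)"
      using card_anticomplete_pairs_eq_if_deck_eq G G' assms(7,9) by metis
    then have "(\<Sum>X\<in>?A. n - c - d X choose j) = (\<Sum>X\<in>?B. n - c - d' X choose j)"
      using fin G(2) G'(2) by (simp add: card_anticomplete_pairs_eq_sum d_def d'_def)
    then show "(\<Sum>X\<in>?A. real (n - c - d X choose j)) = (\<Sum>X\<in>?B. real (n - c - d' X choose j))"
      by (simp only: of_nat_sum[symmetric])
  qed
  then obtain X where X: "X \<subseteq> ?V" "card X = c" "d X = 0" by auto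
  \<comment> \<open>\<open>X\<close> is a proper subset since \<open>1 \<le> c\<close> and
    \<open>10 * c \<le> n\<close>.\<close>
  then have "X \<noteq> {}" "X \<noteq> ?V" using \<open>1 \<le> c\<close> \<open>c \<le> r\<close> r G(2) by auto
  moreover have "?E `` X \<inter> (?V - X) = {}" using X(3) fin by (simp add: d_def)
  then have "?E \<inter> X \<times> (?V - X) = {}" by blast
  ultimately show False using G(3) X(1) unfolding linked_def by blast
qed

theorem theorem1p5:
  fixes G :: "'a pair_pre_digraph" and G' :: "'b pair_pre_digraph" and n l :: nat
  assumes "n \<ge> 3"
    and "9 * real n / 10 \<le> real l" and "l \<le> n"
    and "pair_graph G" and "card (pverts G) = n"
    and "pair_graph G'" and "card (pverts G') = n"
    and "deck l G = deck l G'"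
  shows "Digraph_Component.connected (with_proj G) \<longleftrightarrow> Digraph_Component.connected (with_proj G')"
proof -
  have l: "1 \<le> l" "9 * n \<le> 10 * l" using assms(1,2) by linarith+
  have "pverts G \<noteq> {}" "pverts G' \<noteq> {}" using assms(1,5,7) by auto
  then show ?thesis
    using linked_if_deck_eq[OF assms(4,5) _ assms(6,7) l(1) assms(3) l(2) assms(8)]
      linked_if_deck_eq[OF assms(6,7) _ assms(4,5) l(1) assms(3) l(2) assms(8)[symmetric]]
    unfolding connected_iff_linked[OF assms(4)] connected_iff_linked[OF assms(6)] by blast
qed

end
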